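(* Let $r$ be a rational number and define $P_r(n)$ by the formal power series expansion $$\frac{1}{(q;q)_\infty^{\,r}}=\prod_{k=1}^\infty(1-q^k)^{-r}=\sum_{n=0}^\infty P_r(n)q^n.$$ Then for every non-negative integer $m$: (1) $P_r(5m+1)\equiv0\pmod 5$ if $r\equiv0\pmod5$; (2) $P_r(5m+2)\equiv0\pmod5$ if $r\equiv2\pmod5$; (3) $P_r(5m+3)\equiv0\pmod5$ if $r\equiv4\pmod5$; (4) $P_r(5m+4)\equiv0\pmod5$ if $r\equiv1\pmod5$.
   Context: $(q;q)_\infty=\prod_{k\ge0}(1-q^{k+1})$; for rational $r$, $(1-x)^{-r}=\sum_{j\ge0}\frac{r(r+1)\cdots(r+j-1)}{j!}x^j$. Congruences modulo $5$ between rational numbers are understood for rationals whose denominators are coprime to $5$ (i.e., in the localization of $\mathbb{Z}$ at $5$). *)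

theory Defs
  imports "HOL-Analysis.Analysis"
begin

text \<open>
  The rationals whose denominator (in lowest terms) is coprime to \<open>p\<close>; for prime \<open>p\<close> this is the
  localization of the integers at \<open>p\<close>. Congruence modulo \<open>p\<close> is congruence modulo the ideal
  generated by \<open>p\<close> in this ring, and asserts in particular that both sides belong to the ring.
\<close>

definition localization_at :: "int \<Rightarrow> rat set" where
  "localization_at p = {x. coprime (snd (quotient_of x)) p}"

definition rat_cong :: "int \<Rightarrow> rat \<Rightarrow> rat \<Rightarrow> bool" where
  "rat_cong p x y \<longleftrightarrow>
     x \<in> localization_at p \<and> y \<in> localization_at p \<and>
     (\<exists>z \<in> localization_at p. x - y = of_int p * z)"

text \<open>
  The power series \<open>(1 - x)\<close> to the power \<open>-r\<close>; since \<open>pochhammer r j\<close> is the rising product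
  \<open>r (r + 1) \<dots> (r + j - 1)\<close>, this is the binomial series. The argument \<open>x\<close> is meant to have zero
  constant term, so that the composition is the usual substitution.
\<close>

definition one_minus_power_neg :: "rat fps \<Rightarrow> rat \<Rightarrow> rat fps" where
  "one_minus_power_neg x r = fps_compose (Abs_fps (\<lambda>j. pochhammer r j / fact j)) x"

text \<open>
  The infinite product is taken in the X-adic metric on formal power series. The index is shifted
  so that the factors run over the exponents \<open>k \<ge> 1\<close>.
\<close>

definition euler_power_neg :: "rat \<Rightarrow> rat fps" where
  "euler_power_neg r = (\<Prod>k. one_minus_power_neg (fps_X ^ Suc k) r)"

definition P :: "rat \<Rightarrow> nat \<Rightarrow> rat" where
  "P r n = fps_nth (euler_power_neg r) n"

lemma one_minus_power_neg_nth_0: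
  "fps_nth (one_minus_power_neg (fps_X ^ Suc k) r) 0 = 1"
  by (simp add: one_minus_power_neg_def)

lemma one_minus_power_neg_nth_less:
  assumes "0 < i" "i \<le> k"
  shows "fps_nth (one_minus_power_neg (fps_X ^ Suc k) r) i = 0"
proof -
  have "fps_nth ((fps_X ^ Suc k) ^ j :: rat fps) i = 0" for j
  proof (cases j)
    case 0
    then show ?thesis using assms by simp
  next
    case (Suc l)
    then have "i < Suc k * j" using assms by simp
    then have "fps_nth (fps_X ^ (Suc k * j) :: rat fps) i = 0"
      by (subst fps_X_power_nth) simp
    then show ?thesis by (simp only: power_mult)
  qed
  then show ?thesis
    unfolding one_minus_power_neg_def fps_compose_nth by (simp del: power_Suc)
qed

text \<open>The infinite product converges, so the limit in its definition is the genuine one.\<close>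

lemma has_prod_euler_power_neg:
  "(\<lambda>k. one_minus_power_neg (fps_X ^ Suc k) r) has_prod euler_power_neg r"
proof -
  define f where "f = (\<lambda>k. one_minus_power_neg (fps_X ^ Suc k) r)"
  define G where "G = Abs_fps (\<lambda>n. fps_nth (\<Prod>k\<le>n. f k) n)"
  have f0: "fps_nth (f k) 0 = 1" for k
    unfolding f_def by (rule one_minus_power_neg_nth_0)
  have mult_f: "fps_nth (h * f k) n = fps_nth h n" if "n \<le> k" for h n k
  proof -
    have "fps_nth (h * f k) n = (\<Sum>i=0..n. fps_nth h i * fps_nth (f k) (n - i))"
      by (rule fps_mult_nth)
    also have "\<dots> = (\<Sum>i=0..n. if i = n then fps_nth h n else 0)"
    proof (rule sum.cong)
      fix i assume i: "i \<in> {0..n}"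
      show "fps_nth h i * fps_nth (f k) (n - i) = (if i = n then fps_nth h n else 0)"
      proof (cases "i = n")
        case True
        then show ?thesis using f0 by simp
      next
        case False
        then have "fps_nth (f k) (n - i) = 0"
          unfolding f_def using i that by (intro one_minus_power_neg_nth_less) auto
        then show ?thesis using False by simp
      qed
    qed simp
    finally show ?thesis by simp
  qed
  have stable: "fps_nth (\<Prod>k\<le>N. f k) n = fps_nth (\<Prod>k\<le>n. f k) n" if "n \<le> N" for n N
    using that
  proof (induction N rule: dec_induct)
    case (step N)
    then show ?case by (simp add: mult_f)
  qed simp
  have "(\<lambda>N. \<Prod>k\<le>N. f k) \<longlonglongrightarrow> G"
  proof (rule tendsto_fpsI)
    fix n
    show "\<forall>\<^sub>F N in sequentially. fps_nth (\<Prod>k\<le>N. f k) n = fps_nth G n"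
      using eventually_ge_at_top[of n] by eventually_elim (simp only: G_def fps_nth_Abs_fps, rule stable)
  qed
  moreover have "fps_nth G 0 = 1"
    by (simp add: G_def f0)
  then have "G \<noteq> 0" by auto
  ultimately have "f has_prod G"
    by (simp add: has_prod_def raw_has_prod_def)
  moreover from this have "G = euler_power_neg r"
    unfolding euler_power_neg_def f_def by (rule has_prod_unique)
  ultimately show ?thesis
    by (simp only: f_def)
qed

end

theory Submission
  imports Defs
begin

text \<open>
  Let \<open>e(r)\<close> be the generating function of \<open>P\<^sub>r\<close>, so that \<open>e(r + t) = e(r) e(t)\<close> and \<open>E = e(-1)\<close> is
  the Euler product. If \<open>s\<close> is \<open>5\<close>-integral, then so are the coefficients of \<open>e(s)\<close>, and
  \<open>e(5 s) = e(s)\<^sup>5\<close> is, modulo \<open>5\<close>, a series in \<open>q\<^sup>5\<close>. In the four cases \<open>r = 5 s - a\<close> with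
  \<open>a = 0, 3, 1, 4\<close>, so it suffices to see which exponents modulo \<open>5\<close> occur in \<open>E\<^sup>a\<close>. By the
  pentagonal number theorem \<open>E\<close> lives on the residues \<open>0, 1, 2\<close>; by Jacobi's identity
  \<open>E\<^sup>3 = (\<Sum>j. (-1)\<^sup>j (2 j + 1) q\<^bsup>j (j + 1) / 2\<^esup>)\<close> lives on \<open>0, 1\<close> modulo \<open>5\<close>, because the factor
  \<open>2 j + 1\<close> is divisible by \<open>5\<close> when \<open>j (j + 1) / 2\<close> is \<open>3\<close> modulo \<open>5\<close>; hence \<open>E\<^sup>4 = E E\<^sup>3\<close> avoids
  the residue \<open>4\<close>.
\<close>

section \<open>Finite \<open>q\<close>-identities\<close>

definition q_poch :: "'a::comm_ring_1 \<Rightarrow> nat \<Rightarrow> 'a" where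
  "q_poch q n = (\<Prod>k<n. 1 - q ^ Suc k)"

text \<open>The Gaussian binomial coefficients. Taking the q-Pascal rule as definition avoids
  quotients, so they make sense in every commutative ring, in particular for polynomials and power
  series.\<close>

fun q_binomial :: "'a::comm_ring_1 \<Rightarrow> nat \<Rightarrow> nat \<Rightarrow> 'a" where
  "q_binomial q n 0 = 1"
| "q_binomial q 0 (Suc k) = 0"
| "q_binomial q (Suc n) (Suc k) = q ^ Suc k * q_binomial q n (Suc k) + q_binomial q n k"

lemma Suc_choose_two: "Suc n choose 2 = (n choose 2) + n"
  by (simp add: numeral_2_eq_2)

lemma double_choose_two: "2 * (n choose 2) + n = n * n"
  by (induction n) (auto simp: Suc_choose_two)

lemma q_poch_0 [simp]: "q_poch q 0 = 1"
  by (simp add: q_poch_def)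

lemma q_poch_Suc: "q_poch q (Suc n) = q_poch q n * (1 - q ^ Suc n)"
  by (simp add: q_poch_def)

text \<open>
  A polynomial version of Euler's pentagonal number theorem: modulo \<open>q\<^sup>n\<^sup>+\<^sup>1\<close> only the summand
  \<open>s = 0\<close> on the left survives.
\<close>

lemma shanks_identity:
  fixes q :: "'a::comm_ring_1"
  shows "(\<Sum>s\<le>n. (-1) ^ s * q ^ (s * n + (Suc s choose 2)) * (\<Prod>k=s..<n. 1 - q ^ Suc k)) =
         1 + (\<Sum>s<n. (-1) ^ Suc s * (q ^ (Suc s * Suc s + (Suc s choose 2)) +
                                     q ^ (Suc s * Suc s + (Suc (Suc s) choose 2))))"
proof (induction n)
  case 0
  then show ?case by (simp add: numeral_2_eq_2)
next
  case (Suc n)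
  define \<pi> where "\<pi> s = (\<Prod>k=s..<n. 1 - q ^ Suc k)" for s
  define a where "a m s = (-1) ^ s * q ^ (s * m + (Suc s choose 2)) * (\<Prod>k=s..<m. 1 - q ^ Suc k)"
    for m s
  \<comment> \<open>\<open>U\<close> is the telescoping certificate: the summands for \<open>n + 1\<close> and \<open>n\<close> differ by \<open>U s - U (s + 1)\<close>.\<close>
  define T where "T s = (-1) ^ s * q ^ (Suc s * Suc n + (Suc s choose 2)) * \<pi> s" for s
  define U where "U s = (case s of 0 \<Rightarrow> 0 | Suc u \<Rightarrow> T u)" for s
  have diff: "a (Suc n) s - a n s = U s - U (Suc s)" if "s \<le> n" for s
  proof (cases s)
    case 0
    then show ?thesis
      by (simp add: a_def U_def T_def \<pi>_def algebra_simps numeral_2_eq_2)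
  next
    case (Suc u)
    have \<pi>: "(\<Prod>k=s..<Suc n. 1 - q ^ Suc k) = \<pi> s * (1 - q ^ Suc n)"
            "(\<Prod>k=s..<n. 1 - q ^ Suc k) = \<pi> s"
      using that by (simp_all add: \<pi>_def)
    have \<pi>': "\<pi> u = (1 - q ^ s) * \<pi> s"
      using that Suc by (simp add: \<pi>_def prod.atLeast_Suc_lessThan)
    have eqs: "a (Suc n) s = (-1) ^ s * q ^ (s * Suc n + (Suc s choose 2)) * (\<pi> s * (1 - q ^ Suc n))"
         "a n s = (-1) ^ s * q ^ (s * n + (Suc s choose 2)) * \<pi> s"
         "U s = (-1) ^ u * q ^ (s * Suc n + (s choose 2)) * ((1 - q ^ s) * \<pi> s)"
         "U (Suc s) = (-1) ^ s * q ^ (Suc s * Suc n + (Suc s choose 2)) * \<pi> s"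
      by (simp_all only: a_def U_def T_def \<pi>[unfolded Suc] Suc nat.case \<pi>'[unfolded Suc])
    show ?thesis
      by (simp only: eqs) (simp add: Suc Suc_choose_two power_add algebra_simps)
  qed
  have "(\<Sum>s\<le>n. a (Suc n) s) - (\<Sum>s\<le>n. a n s) = (\<Sum>s\<le>n. U s - U (Suc s))"
    by (simp add: diff flip: sum_subtractf)
  also have "\<dots> = - T n"
    by (subst sum_telescope) (simp add: U_def)
  finally have "(\<Sum>s\<le>Suc n. a (Suc n) s) = (\<Sum>s\<le>n. a n s) + (a (Suc n) (Suc n) - T n)"
    by (simp add: algebra_simps)
  \<comment> \<open>The new summand s = n + 1 and the boundary term of the telescoping sum supply
    the next pair of pentagonal exponents.\<close>
  also have "a (Suc n) (Suc n) - T n = (-1) ^ Suc n *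
      (q ^ (Suc n * Suc n + (Suc n choose 2)) + q ^ (Suc n * Suc n + (Suc (Suc n) choose 2)))"
    by (simp add: a_def T_def \<pi>_def algebra_simps)
  finally show ?case
    using Suc.IH by (simp add: a_def)
qed

section \<open>Gaussian binomial coefficients and a finite form of Jacobi's identity\<close>

lemma q_binomial_eq_0 [simp]: "n < k \<Longrightarrow> q_binomial q n k = 0"
  by (induction q n k rule: q_binomial.induct) auto

lemma q_binomial_self [simp]: "q_binomial q n n = 1"
  by (induction n) auto

text \<open>The division-free quotient formula. In the inductive step the q-Pascal rule produces the
  weights q^k (1 - q^n) and 1 - q^k, whose sum is 1 - q^(n + k).\<close>

lemma q_binomial_q_poch:
  "q_binomial q (n + k) k * (q_poch q k * q_poch q n) = q_poch q (n + k)"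
proof (induction "n + k" arbitrary: n k)
  case (Suc N)
  show ?case
  proof (cases n)
    case [simp]: (Suc m)
    show ?thesis
    proof (cases k)
      case [simp]: (Suc l)
      have "N = m + Suc l" "N = n + l" using Suc.hyps(2) by simp_all
      note IH = Suc.hyps(1)[OF this(1)] Suc.hyps(1)[OF this(2)]
      have "q_binomial q (n + k) k * (q_poch q k * q_poch q n) =
            q ^ k * (1 - q ^ n) * (q_binomial q (m + k) k * (q_poch q k * q_poch q m)) +
            (1 - q ^ k) * (q_binomial q (n + l) l * (q_poch q l * q_poch q n))"
        by (simp add: q_poch_Suc algebra_simps)
      also have "\<dots> = (q ^ k * (1 - q ^ n) + (1 - q ^ k)) * q_poch q (m + k)"
        using IH by (simp add: algebra_simps)
      also have "\<dots> = q_poch q (n + k)"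
        by (simp add: q_poch_Suc power_add algebra_simps)
      finally show ?thesis .
    qed simp
  qed simp
qed simp

text \<open>Splitting off the factor i = 0 replaces x by x q in the others, so x varies in the
  induction. The homogeneous form in x and y permits y = q^n later, where the usual form would need
  negative powers of q.\<close>

theorem q_binomial_theorem:
  "(\<Prod>i<n. y + x * q ^ i) = (\<Sum>k\<le>n. q ^ (k choose 2) * q_binomial q n k * x ^ k * y ^ (n - k))"
proof (induction n arbitrary: x)
  case 0
  then show ?case by (simp add: numeral_2_eq_2)
next
  case (Suc n)
  define c where "c k = q ^ (k choose 2) * q_binomial q n k * (x * q) ^ k * y ^ (n - k)" for k
  have "(\<Prod>i<Suc n. y + x * q ^ i) = (y + x) * (\<Prod>i<n. y + (x * q) * q ^ i)"
    by (simp add: prod.lessThan_Suc_shift mult.assoc del: prod.lessThan_Suc)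
  also have "\<dots> = (\<Sum>k\<le>n. y * c k) + (\<Sum>k\<le>n. x * c k)"
    by (simp only: Suc.IH c_def distrib_right) (simp only: sum_distrib_left)
  also have "(\<Sum>k\<le>n. y * c k) = (\<Sum>k\<le>Suc n. q ^ (k choose 2) * q_binomial q n k * (x * q) ^ k * y ^ (Suc n - k))"
    by (simp add: c_def Suc_diff_le mult_ac)
  also have "\<dots> = y ^ Suc n + (\<Sum>k\<le>n. q ^ (Suc k choose 2) * q_binomial q n (Suc k) * (x * q) ^ Suc k * y ^ (n - k))"
    by (subst sum.atMost_Suc_shift) (simp add: numeral_2_eq_2)
  also have "\<dots> + (\<Sum>k\<le>n. x * c k) = y ^ Suc n + (\<Sum>k\<le>n. q ^ (Suc k choose 2) * q_binomial q (Suc n) (Suc k) * x ^ Suc k * y ^ (n - k))"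
    unfolding c_def add.assoc
    by (simp add: Suc_choose_two power_add power_mult_distrib algebra_simps flip: sum.distrib)
  also have "\<dots> = (\<Sum>k\<le>Suc n. q ^ (k choose 2) * q_binomial q (Suc n) k * x ^ k * y ^ (Suc n - k))"
    unfolding sum.atMost_Suc_shift by (simp add: numeral_2_eq_2)
  finally show ?case .
qed

text \<open>Lets the q-binomial theorem be used over the polynomial ring with q a constant and x the
  variable, so that it can be differentiated in x.\<close>

lemma q_binomial_pCons: "q_binomial [:q:] n k = [:q_binomial q n k:]"
  by (induction q n k rule: q_binomial.induct) (simp_all add: poly_const_pow one_pCons mult.commute)

lemma pderiv_sum: "pderiv (sum f A) = (\<Sum>x\<in>A. pderiv (f x))"
  by (induction A rule: infinite_finite_induct) (simp_all add: pderiv_add)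

text \<open>
  The \<open>q\<close>-binomial theorem expands the product of \<open>q\<^sup>n - x q\<^sup>i\<close> over \<open>0 \<le> i \<le> 2 n\<close>; the factor
  \<open>i = n\<close> vanishes at \<open>x = 1\<close>, so differentiating there leaves the product of the other factors.
\<close>

lemma finite_jacobi_identity:
  fixes q :: "'a::idom"
  assumes "q \<noteq> 0"
  shows "q_poch q n ^ 2 = (\<Sum>j\<le>n. (-1) ^ j * q ^ (Suc j choose 2) *
           (of_nat (n + Suc j) * q_binomial q (n + Suc n) (n + Suc j)
            - of_nat (n - j) * q_binomial q (n + Suc n) (n - j)))"
proof -
  define N where "N = n + Suc n"
  define c where "c k = (-1) ^ k * q ^ ((k choose 2) + n * (N - k)) * q_binomial q N k" for k
  define R where "R = (\<Prod>i<n. [:q ^ n, - (q ^ i):]) * (\<Prod>i<n. [:q ^ n, - (q ^ (n + Suc i)):])"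
  \<comment> \<open>The power of q to be cancelled at the end: n from the derivative of the
    vanishing factor, n choose 2 from the factors i < n, and n n from the factors i > n.\<close>
  define e where "e = n + (n choose 2) + n * n"
  have "(\<Prod>i<N. [:q ^ n, - (q ^ i):]) = (\<Prod>i<n. [:q ^ n, - (q ^ i):]) * (\<Prod>i=n..<N. [:q ^ n, - (q ^ i):])"
    unfolding lessThan_atLeast0 by (rule prod.atLeastLessThan_concat[symmetric]) (simp_all add: N_def)
  also have "(\<Prod>i=n..<N. [:q ^ n, - (q ^ i):]) = (\<Prod>i<Suc n. [:q ^ n, - (q ^ (n + i)):])"
    using prod.shift_bounds_nat_ivl[of "\<lambda>i. [:q ^ n, - (q ^ i):]" 0 n "Suc n"]
    by (simp only: N_def lessThan_atLeast0 add_0 add.commute)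
  also have "\<dots> = [:q ^ n, - (q ^ n):] * (\<Prod>i<n. [:q ^ n, - (q ^ (n + Suc i)):])"
    by (subst prod.lessThan_Suc_shift) simp
  finally have 1: "(\<Prod>i<N. [:q ^ n, - (q ^ i):]) = [:q ^ n, - (q ^ n):] * R"
    by (simp only: R_def mult_ac)
  have "(\<Prod>i<N. [:q ^ n, - (q ^ i):]) = (\<Prod>i<N. [:q:] ^ n + [:0, -1:] * [:q:] ^ i)"
    by (simp add: poly_const_pow)
  also have "\<dots> = (\<Sum>k\<le>N. monom (c k) k)"
    unfolding q_binomial_theorem
  proof (rule sum.cong)
    fix k
    have "[:0, -1:] = monom (-1 :: 'a) 1"
      by (simp add: monom_Suc monom_0)
    then have "[:0, -1:] ^ k = monom ((-1) ^ k :: 'a) k"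
      by (simp add: monom_power)
    then show "[:q:] ^ (k choose 2) * q_binomial [:q:] N k * [:0, -1:] ^ k * ([:q:] ^ n) ^ (N - k) = monom (c k) k"
      by (simp add: q_binomial_pCons poly_const_pow c_def smult_monom power_add power_mult mult_ac)
  qed simp
  finally have "poly (pderiv ([:q ^ n, - (q ^ n):] * R)) 1 = (\<Sum>k\<le>N. of_nat k * c k)"
    by (simp add: 1 pderiv_sum pderiv_monom poly_sum poly_monom)
  moreover have "poly (pderiv ([:q ^ n, - (q ^ n):] * R)) 1 = - (q ^ n * poly R 1)"
    by (simp only: pderiv_mult) (simp add: pderiv_pCons)
  ultimately have 2: "- (q ^ n * poly R 1) = (\<Sum>k\<le>N. of_nat k * c k)" by simp

  have "(\<Prod>i<n. q ^ n - q ^ i) = (\<Prod>i<n. (-1) * q ^ i * (1 - q ^ (n - i)))"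
    by (intro prod.cong) (auto simp: algebra_simps simp flip: power_add)
  also have "\<dots> = (-1) ^ n * (\<Prod>i<n. q ^ i) * (\<Prod>i<n. 1 - q ^ Suc (n - Suc i))"
    unfolding prod.distrib by (simp add: Suc_diff_Suc del: power_Suc)
  also have "(\<Prod>i<n. q ^ i) = q ^ (n choose 2)"
    by (induction n) (simp_all add: Suc_choose_two power_add numeral_2_eq_2)
  also have "(\<Prod>i<n. 1 - q ^ Suc (n - Suc i)) = q_poch q n"
    unfolding q_poch_def by (rule prod.nat_diff_reindex)
  finally have 3: "(\<Prod>i<n. q ^ n - q ^ i) = (-1) ^ n * q ^ (n choose 2) * q_poch q n" .
  have "(\<Prod>i<n. q ^ n - q ^ (n + Suc i)) = (\<Prod>i<n. q ^ n * (1 - q ^ Suc i))"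
    by (simp add: power_add algebra_simps)
  also have "\<dots> = q ^ (n * n) * q_poch q n"
    by (simp add: prod.distrib q_poch_def power_mult)
  finally have "q ^ n * poly R 1 = (-1) ^ n * q ^ e * q_poch q n ^ 2"
    using 3 by (simp add: R_def poly_prod e_def power_add power2_eq_square mult_ac)
  with 2 have "(-1) ^ Suc n * q ^ e * q_poch q n ^ 2 = (\<Sum>k\<le>N. of_nat k * c k)"
    by simp
  \<comment> \<open>The indices k = n - j and k = n + 1 + j are paired. Apart from the common q^e
    both carry the exponent \<open>Suc j choose 2\<close>, and their signs are opposite.\<close>
  also have "\<dots> = (\<Sum>k<Suc n. of_nat k * c k) + (\<Sum>k=Suc n..<Suc n + Suc n. of_nat k * c k)"
    unfolding lessThan_Suc_atMost[symmetric] lessThan_atLeast0 N_def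
    by (subst sum.atLeastLessThan_concat) simp_all
  also have "(\<Sum>k<Suc n. of_nat k * c k) = (\<Sum>j\<le>n. of_nat (n - j) * c (n - j))"
    using sum.nat_diff_reindex[of "\<lambda>k. of_nat k * c k" "Suc n"] by (simp only: lessThan_Suc_atMost diff_Suc_Suc)
  also have "(\<Sum>k=Suc n..<Suc n + Suc n. of_nat k * c k) = (\<Sum>j\<le>n. of_nat (n + Suc j) * c (n + Suc j))"
    using sum.shift_bounds_nat_ivl[of "\<lambda>k. of_nat k * c k" 0 "Suc n" "Suc n"]
    by (simp add: lessThan_atLeast0 add_ac flip: lessThan_Suc_atMost)
  also have "(\<Sum>j\<le>n. of_nat (n - j) * c (n - j)) + (\<Sum>j\<le>n. of_nat (n + Suc j) * c (n + Suc j)) =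
     (\<Sum>j\<le>n. (-1) ^ Suc n * q ^ e * ((-1) ^ j * q ^ (Suc j choose 2) *
        (of_nat (n + Suc j) * q_binomial q N (n + Suc j) - of_nat (n - j) * q_binomial q N (n - j))))"
    unfolding sum.distrib[symmetric]
  proof (rule sum.cong)
    fix j assume "j \<in> {..n}"
    then obtain d where n: "n = j + d" by (auto simp: le_iff_add)
    \<comment> \<open>Doubling and adding d + j turns each binomial into a square by
      \<open>double_choose_two\<close>, leaving a polynomial identity.\<close>
    have "2 * ((d choose 2) + n * (N - d)) + d + j = 2 * (e + (Suc j choose 2)) + d + j"
      using double_choose_two[of d] double_choose_two[of n] double_choose_two[of j]
      by (simp add: e_def N_def n Suc_choose_two algebra_simps)
    then have exp1: "((n - j) choose 2) + n * (N - (n - j)) = e + (Suc j choose 2)"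
      by (simp add: n)
    have "2 * ((n + Suc j choose 2) + n * (N - (n + Suc j))) + n + j = 2 * (e + (Suc j choose 2)) + n + j"
      using double_choose_two[of "n + j"] double_choose_two[of n] double_choose_two[of j]
      by (simp add: e_def N_def n Suc_choose_two algebra_simps)
    then have exp2: "(n + Suc j choose 2) + n * (N - (n + Suc j)) = e + (Suc j choose 2)"
      by simp
    have sgn: "(-1) ^ (n - j) = (-1 :: 'a) ^ n * (-1) ^ j"
      by (simp add: n power_add mult_ac flip: power_mult_distrib)
    show "of_nat (n - j) * c (n - j) + of_nat (n + Suc j) * c (n + Suc j) =
      (-1) ^ Suc n * q ^ e * ((-1) ^ j * q ^ (Suc j choose 2) *
        (of_nat (n + Suc j) * q_binomial q N (n + Suc j) - of_nat (n - j) * q_binomial q N (n - j)))"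
      unfolding c_def exp1 exp2 sgn by (simp only: power_add power_Suc) (simp add: algebra_simps)
  qed simp
  finally show ?thesis
    using \<open>q \<noteq> 0\<close> by (simp add: sum_negf N_def flip: sum_distrib_left)
qed

section \<open>Powers of the Euler product\<close>

text \<open>Truncation is expressed from here on as divisibility of a difference by a power of
  \<open>fps_X\<close>; limits are needed only for \<open>euler_power_neg_approx\<close>.\<close>

lemma fps_X_power_dvd_iff:
  fixes f :: "'a::comm_ring_1 fps"
  shows "fps_X ^ n dvd f \<longleftrightarrow> (\<forall>i<n. fps_nth f i = 0)"
proof
  assume "fps_X ^ n dvd f"
  then show "\<forall>i<n. fps_nth f i = 0"
    by (auto simp: fps_X_power_mult_nth)
next
  assume "\<forall>i<n. fps_nth f i = 0"
  then have "f = fps_X ^ n * fps_shift n f"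
    by (intro fps_ext) (auto simp: fps_X_power_mult_nth)
  then show "fps_X ^ n dvd f" by (rule dvdI)
qed

lemma dvd_diff_mult:
  fixes a :: "'a::comm_ring_1"
  assumes "d dvd a - b" "d dvd a' - b'"
  shows "d dvd a * a' - b * b'"
proof -
  have "a * a' - b * b' = (a - b) * a' + b * (a' - b')"
    by (simp add: algebra_simps)
  then show ?thesis using assms by (simp only: dvd_add dvd_mult2 dvd_mult)
qed

lemma dvd_diff_trans:
  fixes a :: "'a::comm_ring_1"
  assumes "d dvd a - b" "d dvd b - c"
  shows "d dvd a - c"
  using dvd_add[OF assms] by simp

lemma dvd_diff_sym:
  fixes a :: "'a::comm_ring_1"
  shows "d dvd a - b \<Longrightarrow> d dvd b - a"
  by (metis dvd_minus_iff minus_diff_eq)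

text \<open>The Vandermonde identity for rising factorials is exactly the Cauchy product of the two
  binomial series.\<close>

lemma one_minus_power_neg_add:
  assumes "fps_nth x 0 = 0"
  shows "one_minus_power_neg x (r + t) = one_minus_power_neg x r * one_minus_power_neg x t"
proof -
  have "Abs_fps (\<lambda>j. pochhammer (r + t) j / fact j) =
        Abs_fps (\<lambda>j. pochhammer r j / fact j) * Abs_fps (\<lambda>j. pochhammer t j / fact j)"
    by (intro fps_ext)
       (simp add: fps_mult_nth pochhammer_binomial_sum sum_divide_distrib binomial_fact
         atLeast0AtMost field_simps)
  then show ?thesis
    using assms by (simp add: one_minus_power_neg_def fps_compose_mult_distrib)
qed

lemma one_minus_power_neg_minus_1:
  assumes "fps_nth x 0 = 0"
  shows "one_minus_power_neg x (-1) = 1 - x"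
proof -
  have "pochhammer (-1) j / fact j = fps_nth (1 - fps_X :: rat fps) j" for j
  proof -
    consider "j = 0" | "j = 1" | i where "j = Suc (Suc i)"
      by (metis One_nat_def not0_implies_Suc)
    then show ?thesis
      by cases (simp_all add: pochhammer_rec)
  qed
  then have "Abs_fps (\<lambda>j. pochhammer (-1) j / fact j) = (1 - fps_X :: rat fps)"
    by (intro fps_ext) simp
  then show ?thesis
    using assms by (simp add: one_minus_power_neg_def fps_compose_sub_distrib fps_X_fps_compose_startby0)
qed

text \<open>The factor with index k is 1 modulo X^(k + 1), so factors beyond n do not change the
  coefficients up to n. These finitely many coefficients agree with those of the limit at a common
  large N.\<close>

lemma euler_power_neg_approx:
  "fps_X ^ Suc n dvd euler_power_neg r - (\<Prod>k\<le>n. one_minus_power_neg (fps_X ^ Suc k) r)"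
proof -
  define f where "f k = one_minus_power_neg (fps_X ^ Suc k) r" for k
  have f_approx: "fps_X ^ Suc k dvd f k - 1" for k
    unfolding fps_X_power_dvd_iff
  proof (intro allI impI)
    fix i assume "i < Suc k"
    then show "fps_nth (f k - 1) i = 0"
      using one_minus_power_neg_nth_0[of k r] one_minus_power_neg_nth_less[of i k r]
      by (cases "i = 0") (simp_all add: f_def del: power_Suc)
  qed
  have approx: "fps_X ^ Suc n dvd (\<Prod>k\<le>N. f k) - (\<Prod>k\<le>n. f k)" if "n \<le> N" for N
    using that
  proof (induction N rule: dec_induct)
    case (step N)
    have "fps_X ^ Suc n dvd f (Suc N) - 1"
      by (rule dvd_trans[OF le_imp_power_dvd f_approx]) (use step.hyps in simp)
    then have "fps_X ^ Suc n dvd (\<Prod>k\<le>N. f k) * f (Suc N) - (\<Prod>k\<le>n. f k) * 1"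
      by (intro dvd_diff_mult step.IH)
    then show ?case by simp
  qed simp
  \<comment> \<open>This excludes the case of \<open>has_prod\<close> that allows a zero factor, so
    the plain partial products converge.\<close>
  have "f k \<noteq> 0" for k
    using one_minus_power_neg_nth_0[of k r] unfolding f_def by (metis fps_zero_nth zero_neq_one)
  then have "(\<lambda>N. \<Prod>k\<le>N. f k) \<longlonglongrightarrow> euler_power_neg r"
    using has_prod_euler_power_neg[of r] unfolding has_prod_def raw_has_prod_def
    by (auto simp: f_def simp del: power_Suc)
  then have "eventually (\<lambda>N. \<forall>i\<in>{..n}. fps_nth (\<Prod>k\<le>N. f k) i = fps_nth (euler_power_neg r) i) sequentially"
    by (intro eventually_ball_finite) (auto simp: tendsto_fps_iff)
  then obtain N where "n \<le> N" "\<And>i. i \<le> n \<Longrightarrow> fps_nth (\<Prod>k\<le>N. f k) i = fps_nth (euler_power_neg r) i"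
    unfolding eventually_sequentially by (metis atMost_iff nat_le_linear)
  then have "fps_X ^ Suc n dvd euler_power_neg r - (\<Prod>k\<le>N. f k)"
    unfolding fps_X_power_dvd_iff by simp
  then show ?thesis
    using approx[OF \<open>n \<le> N\<close>] unfolding f_def by (rule dvd_diff_trans)
qed

lemma fps_eqI_X_power_dvd:
  fixes f :: "'a::comm_ring_1 fps"
  assumes "\<And>n. fps_X ^ Suc n dvd f - g"
  shows "f = g"
  using assms by (intro fps_ext) (metis eq_iff_diff_eq_0 fps_X_power_dvd_iff fps_sub_nth lessI)

lemma euler_power_neg_add: "euler_power_neg (r + t) = euler_power_neg r * euler_power_neg t"
proof (rule fps_eqI_X_power_dvd)
  fix n
  let ?f = "\<lambda>r k. one_minus_power_neg (fps_X ^ Suc k) r"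
  have "(\<Prod>k\<le>n. ?f (r + t) k) = (\<Prod>k\<le>n. ?f r k) * (\<Prod>k\<le>n. ?f t k)"
    by (simp add: one_minus_power_neg_add prod.distrib)
  with euler_power_neg_approx[of n "r + t"]
  have "fps_X ^ Suc n dvd euler_power_neg (r + t) - (\<Prod>k\<le>n. ?f r k) * (\<Prod>k\<le>n. ?f t k)"
    by (simp only:)
  moreover have "fps_X ^ Suc n dvd (\<Prod>k\<le>n. ?f r k) * (\<Prod>k\<le>n. ?f t k) - euler_power_neg r * euler_power_neg t"
    by (intro dvd_diff_sym[OF dvd_diff_mult] euler_power_neg_approx)
  ultimately show "fps_X ^ Suc n dvd euler_power_neg (r + t) - euler_power_neg r * euler_power_neg t"
    by (rule dvd_diff_trans)
qed

lemma euler_power_neg_nth_0 [simp]: "fps_nth (euler_power_neg r) 0 = 1"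
proof -
  have "fps_nth (euler_power_neg r - (\<Prod>k\<le>0. one_minus_power_neg (fps_X ^ Suc k) r)) 0 = 0"
    using euler_power_neg_approx[of 0 r] unfolding fps_X_power_dvd_iff by blast
  then show ?thesis
    using one_minus_power_neg_nth_0[of 0 r] by simp
qed

lemma euler_power_neg_0 [simp]: "euler_power_neg 0 = 1"
proof -
  have "euler_power_neg 0 \<noteq> 0"
    by (metis euler_power_neg_nth_0 fps_zero_nth zero_neq_one)
  moreover have "euler_power_neg 0 * euler_power_neg 0 = euler_power_neg 0 * 1"
    using euler_power_neg_add[of 0 0] by (simp only: add_0 mult_1_right)
  ultimately show ?thesis
    by (simp only: mult_cancel_left) simp
qed

lemma euler_power_neg_of_nat_mult: "euler_power_neg (of_nat n * r) = euler_power_neg r ^ n"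
  by (induction n) (simp_all add: distrib_right euler_power_neg_add)

lemma euler_power_neg_minus_1_approx:
  assumes "n \<le> m"
  shows "fps_X ^ Suc n dvd euler_power_neg (-1) - q_poch fps_X m"
proof -
  have "(\<Prod>k\<le>m. one_minus_power_neg (fps_X ^ Suc k) (-1)) = q_poch fps_X (Suc m)"
    by (simp add: q_poch_def one_minus_power_neg_minus_1 lessThan_Suc_atMost)
  then have "fps_X ^ Suc m dvd euler_power_neg (-1) - q_poch fps_X (Suc m)"
    using euler_power_neg_approx[of m "-1"] by simp
  \<comment> \<open>The product over k \<le> m has m + 1 factors; the last one, 1 - X^(m + 1), is
    invisible at this precision.\<close>
  moreover have "fps_X ^ Suc m dvd q_poch fps_X (Suc m) - (q_poch fps_X m :: rat fps)"
    unfolding q_poch_Suc by (simp add: algebra_simps)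
  ultimately have "fps_X ^ Suc m dvd euler_power_neg (-1) - q_poch fps_X m"
    by (rule dvd_diff_trans)
  with assms show ?thesis
    by (meson Suc_le_mono dvd_trans le_imp_power_dvd)
qed

text \<open>Far from both ends of its row a Gaussian binomial B approximates 1/E, where E is the
  Euler product: \<open>q_binomial_q_poch\<close> becomes B E^2 = E up to X^(n + 1), and multiplying
  by \<open>euler_power_neg 1\<close> cancels one E.\<close>

lemma euler_mult_q_binomial_approx:
  assumes "n \<le> a" "n \<le> b"
  shows "fps_X ^ Suc n dvd euler_power_neg (-1) * q_binomial fps_X (a + b) b - 1"
proof -
  let ?E = "euler_power_neg (-1)" and ?B = "q_binomial fps_X (a + b) b :: rat fps"
  have "fps_X ^ Suc n dvd ?B * (?E * ?E) - ?B * (q_poch fps_X b * q_poch fps_X a)"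
    using assms by (intro dvd_diff_mult euler_power_neg_minus_1_approx) auto
  moreover have "fps_X ^ Suc n dvd q_poch fps_X (a + b) - ?E"
    using assms by (intro dvd_diff_sym[OF euler_power_neg_minus_1_approx]) auto
  ultimately have "fps_X ^ Suc n dvd ?B * (?E * ?E) - ?E"
    unfolding q_binomial_q_poch by (rule dvd_diff_trans)
  then have "fps_X ^ Suc n dvd (?B * (?E * ?E) - ?E) * euler_power_neg 1"
    by (rule dvd_mult2)
  also have "(?B * (?E * ?E) - ?E) * euler_power_neg 1 = (?E * ?B - 1) * (?E * euler_power_neg 1)"
    by (simp add: algebra_simps)
  also have "?E * euler_power_neg 1 = 1"
    by (simp flip: euler_power_neg_add)
  finally show ?thesis by simp
qed

section \<open>Localized rationals\<close>

text \<open>Fractions need not be in lowest terms here, so the closure lemmas can multiply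
  denominators without reducing.\<close>

lemma localization_at_iff:
  "x \<in> localization_at p \<longleftrightarrow> (\<exists>a b. b \<noteq> 0 \<and> coprime b p \<and> x = of_int a / of_int b)"
proof
  assume x: "x \<in> localization_at p"
  obtain a b where q: "quotient_of x = (a, b)" by fastforce
  then show "\<exists>a b. b \<noteq> 0 \<and> coprime b p \<and> x = of_int a / of_int b"
    using x quotient_of_denom_pos[OF q] quotient_of_div[OF q]
    by (intro exI[of _ a] exI[of _ b]) (auto simp: localization_at_def)
next
  assume "\<exists>a b. b \<noteq> 0 \<and> coprime b p \<and> x = of_int a / of_int b"
  then obtain a b where ab: "b \<noteq> 0" "coprime b p" "x = of_int a / of_int b" by blast
  obtain c d where q: "quotient_of x = (c, d)" by fastforce
  have "d > 0" "coprime c d" "x = of_int c / of_int d"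
    using quotient_of_denom_pos[OF q] quotient_of_coprime[OF q] quotient_of_div[OF q] by auto
  then have "(of_int (a * d) :: rat) = of_int (c * b)"
    using ab by (simp add: field_simps)
  then have "a * d = c * b" by (simp only: of_int_eq_iff)
  then have "d dvd c * b" by (metis dvd_triv_right)
  then have "d dvd b" using \<open>coprime c d\<close> by (simp add: coprime_dvd_mult_right_iff coprime_commute)
  then have "coprime d p" using \<open>coprime b p\<close> by (metis coprime_divisors dvd_refl)
  then show "x \<in> localization_at p" using q by (simp add: localization_at_def)
qed

lemma of_int_in_localization [simp]: "of_int a \<in> localization_at p"
  unfolding localization_at_iff by (rule exI[of _ a], rule exI[of _ 1]) simp

lemma of_nat_in_localization [simp]: "of_nat a \<in> localization_at p"
  using of_int_in_localization[of "int a" p] by simp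

lemma zero_in_localization [simp]: "0 \<in> localization_at p"
  using of_int_in_localization[of 0 p] by simp

lemma one_in_localization [simp]: "1 \<in> localization_at p"
  using of_int_in_localization[of 1 p] by simp

lemma localization_add: "x \<in> localization_at p \<Longrightarrow> y \<in> localization_at p \<Longrightarrow> x + y \<in> localization_at p"
  unfolding localization_at_iff
proof (elim exE conjE)
  fix a b c d :: int
  assume "b \<noteq> 0" "coprime b p" "x = of_int a / of_int b" "d \<noteq> 0" "coprime d p" "y = of_int c / of_int d"
  then show "\<exists>a b. b \<noteq> 0 \<and> coprime b p \<and> x + y = of_int a / of_int b"
    by (intro exI[of _ "a * d + c * b"] exI[of _ "b * d"]) (simp add: field_simps)
qed

lemma localization_mult: "x \<in> localization_at p \<Longrightarrow> y \<in> localization_at p \<Longrightarrow> x * y \<in> localization_at p"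
  unfolding localization_at_iff
proof (elim exE conjE)
  fix a b c d :: int
  assume "b \<noteq> 0" "coprime b p" "x = of_int a / of_int b" "d \<noteq> 0" "coprime d p" "y = of_int c / of_int d"
  then show "\<exists>a b. b \<noteq> 0 \<and> coprime b p \<and> x * y = of_int a / of_int b"
    by (intro exI[of _ "a * c"] exI[of _ "b * d"]) (simp add: field_simps)
qed

lemma localization_uminus: "x \<in> localization_at p \<Longrightarrow> - x \<in> localization_at p"
  using localization_mult[OF of_int_in_localization[of "-1" p], of x] by simp

lemma localization_diff: "x \<in> localization_at p \<Longrightarrow> y \<in> localization_at p \<Longrightarrow> x - y \<in> localization_at p"
  using localization_add[of x p "- y"] localization_uminus[of y p] by simp

lemma localization_sum: "(\<And>i. i \<in> A \<Longrightarrow> f i \<in> localization_at p) \<Longrightarrow> sum f A \<in> localization_at p"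
  by (induction A rule: infinite_finite_induct) (auto intro: localization_add)

lemma localization_divide_of_nat:
  assumes "x \<in> localization_at (int p)" "b > 0" "coprime b p"
  shows "x / of_nat b \<in> localization_at (int p)"
proof -
  have "of_int 1 / of_int (int b) \<in> localization_at (int p)"
    unfolding localization_at_iff
    by (rule exI[of _ 1], rule exI[of _ "int b"]) (use assms in simp)
  then show ?thesis
    using localization_mult[OF assms(1)] by fastforce
qed

lemma rat_cong_0_iff: "rat_cong p x 0 \<longleftrightarrow> (\<exists>z\<in>localization_at p. x = of_int p * z)"
  by (auto simp: rat_cong_def intro: localization_mult)

lemma rat_cong_0_add: "rat_cong p x 0 \<Longrightarrow> rat_cong p y 0 \<Longrightarrow> rat_cong p (x + y) 0"
  unfolding rat_cong_0_iff by (metis distrib_left localization_add)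

lemma rat_cong_0_mult: "rat_cong p x 0 \<Longrightarrow> y \<in> localization_at p \<Longrightarrow> rat_cong p (x * y) 0"
  unfolding rat_cong_0_iff by (metis mult.assoc localization_mult)

lemma rat_cong_0_sum: "(\<And>i. i \<in> A \<Longrightarrow> rat_cong p (f i) 0) \<Longrightarrow> rat_cong p (sum f A) 0"
proof (induction A rule: infinite_finite_induct)
  case (insert i A)
  then show ?case by (simp add: rat_cong_0_add)
qed (auto simp: rat_cong_0_iff)

section \<open>Power series supported on residue classes\<close>

text \<open>One notion for two purposes: with S = \<open>UNIV\<close> it says only that the
  coefficients are p-integral, with smaller S it also restricts the exponents that survive modulo
  p.\<close>

definition supp_mod :: "nat \<Rightarrow> nat set \<Rightarrow> rat fps set" where
  "supp_mod p S = {f. \<forall>n. fps_nth f n \<in> localization_at p \<and>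
                          (n mod p \<notin> S \<longrightarrow> rat_cong p (fps_nth f n) 0)}"

lemma supp_modI:
  assumes "\<And>n. fps_nth f n \<in> localization_at p"
    and "\<And>n. n mod p \<notin> S \<Longrightarrow> rat_cong p (fps_nth f n) 0"
  shows "f \<in> supp_mod p S"
  using assms by (simp add: supp_mod_def)

lemma supp_mod_nth: "f \<in> supp_mod p S \<Longrightarrow> fps_nth f n \<in> localization_at p"
  and supp_mod_cong_0: "f \<in> supp_mod p S \<Longrightarrow> n mod p \<notin> S \<Longrightarrow> rat_cong p (fps_nth f n) 0"
  by (simp_all add: supp_mod_def)

lemma supp_mod_UNIV: "f \<in> supp_mod p UNIV \<longleftrightarrow> (\<forall>n. fps_nth f n \<in> localization_at p)"
  by (simp add: supp_mod_def)

lemma supp_mod_add: "f \<in> supp_mod p S \<Longrightarrow> g \<in> supp_mod p S \<Longrightarrow> f + g \<in> supp_mod p S"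
  by (simp add: supp_mod_def localization_add rat_cong_0_add)

lemma supp_mod_zero: "0 \<in> supp_mod p S"
  by (auto simp: supp_mod_def rat_cong_0_iff)

lemma supp_mod_sum: "(\<And>i. i \<in> A \<Longrightarrow> f i \<in> supp_mod p S) \<Longrightarrow> sum f A \<in> supp_mod p S"
  by (induction A rule: infinite_finite_induct) (auto intro: supp_mod_add supp_mod_zero)

lemma supp_mod_monomial:
  assumes "c \<in> localization_at p" "k mod p \<in> S \<or> rat_cong p c 0"
  shows "fps_const c * fps_X ^ k \<in> supp_mod p S"
  using assms by (intro supp_modI) (auto simp: rat_cong_0_iff)

lemma supp_mod_one: "1 \<in> supp_mod p UNIV"
  by (simp add: supp_mod_UNIV)

lemma supp_mod_mult:
  assumes f: "f \<in> supp_mod p S" and g: "g \<in> supp_mod p T"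
    and ST: "\<And>i j. i \<in> S \<Longrightarrow> j \<in> T \<Longrightarrow> (i + j) mod p \<in> U"
  shows "f * g \<in> supp_mod p U"
proof (rule supp_modI)
  fix n
  show "fps_nth (f * g) n \<in> localization_at p"
    unfolding fps_mult_nth by (intro localization_sum localization_mult supp_mod_nth[OF f] supp_mod_nth[OF g])
next
  fix n assume n: "n mod p \<notin> U"
  show "rat_cong p (fps_nth (f * g) n) 0"
    unfolding fps_mult_nth
  proof (rule rat_cong_0_sum)
    fix i assume "i \<in> {0..n}"
    then have "(i mod p + (n - i) mod p) mod p = n mod p"
      by (simp add: mod_add_eq)
    then have "i mod p \<notin> S \<or> (n - i) mod p \<notin> T"
      using ST n by metis
    then show "rat_cong p (fps_nth f i * fps_nth g (n - i)) 0"
    proof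
      assume "i mod p \<notin> S"
      then show ?thesis by (intro rat_cong_0_mult supp_mod_cong_0[OF f] supp_mod_nth[OF g])
    next
      assume "(n - i) mod p \<notin> T"
      then have "rat_cong p (fps_nth g (n - i) * fps_nth f i) 0"
        by (intro rat_cong_0_mult supp_mod_cong_0[OF g] supp_mod_nth[OF f])
      then show ?thesis by (simp only: mult.commute)
    qed
  qed
qed

lemma supp_mod_power: "f \<in> supp_mod p UNIV \<Longrightarrow> f ^ n \<in> supp_mod p UNIV"
  by (induction n) (auto intro: supp_mod_one supp_mod_mult)

lemma supp_mod_approx:
  assumes "\<And>n. \<exists>g\<in>supp_mod p S. fps_X ^ Suc n dvd f - g"
  shows "f \<in> supp_mod p S"
proof (rule supp_modI)
  have eq: "\<exists>g\<in>supp_mod p S. fps_nth f n = fps_nth g n" for n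
    using assms[of n] unfolding fps_X_power_dvd_iff by auto
  show "fps_nth f n \<in> localization_at p" for n
    using eq[of n] supp_mod_nth by metis
  show "rat_cong p (fps_nth f n) 0" if "n mod p \<notin> S" for n
    using eq[of n] supp_mod_cong_0[of _ p S n] that by metis
qed

text \<open>The constant term 1 lets the coefficients of g be computed recursively without
  division.\<close>

lemma supp_mod_inverse:
  assumes f: "f \<in> supp_mod p UNIV" and "fps_nth f 0 = 1" "f * g = 1"
  shows "g \<in> supp_mod p UNIV"
proof -
  have "fps_nth g n \<in> localization_at p" for n
  proof (induction n rule: less_induct)
    case (less n)
    have "fps_nth (f * g) n = fps_nth g n + (\<Sum>i=1..n. fps_nth f i * fps_nth g (n - i))"
      using assms(2) by (simp add: fps_mult_nth sum.atLeast_Suc_atMost)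
    then have "fps_nth g n = fps_nth 1 n - (\<Sum>i=1..n. fps_nth f i * fps_nth g (n - i))"
      using assms(3) by simp
    also have "\<dots> \<in> localization_at p"
      by (intro localization_diff localization_sum localization_mult supp_mod_nth[OF f] less.IH) auto
    finally show ?case .
  qed
  then show ?thesis by (simp add: supp_mod_UNIV)
qed

text \<open>At the first degree where f and g may differ, the m-th power acts linearly: f^m - g^m is
  f - g times a sum of m products, each with constant term 1.\<close>

lemma fps_nth_power_diff:
  fixes f g :: "'a::comm_ring_1 fps"
  assumes "fps_X ^ n dvd f - g" "fps_nth f 0 = 1" "fps_nth g 0 = 1"
  shows "fps_nth (f ^ m) n - fps_nth (g ^ m) n = of_nat m * (fps_nth f n - fps_nth g n)"
proof -
  from assms(1) obtain h where h: "f - g = fps_X ^ n * h" by (rule dvdE)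
  have "f ^ m - g ^ m = fps_X ^ n * (h * (\<Sum>i<m. g ^ (m - Suc i) * f ^ i))"
    by (simp add: power_diff_sumr2 h mult.assoc)
  then have "fps_nth (f ^ m - g ^ m) n = fps_nth h 0 * of_nat m"
    by (simp add: fps_X_power_mult_nth fps_sum_nth fps_power_zeroth assms)
  moreover have "fps_nth (f - g) n = fps_nth h 0"
    by (simp add: h fps_X_power_mult_nth)
  ultimately show ?thesis by (simp add: mult.commute)
qed

text \<open>Induction on the degree. Comparing f with its truncation g below degree n shows that the
  n-th coefficients of f^m and g^m differ by m times that of f, and m is invertible.\<close>

lemma supp_mod_root:
  assumes f: "f ^ m \<in> supp_mod p UNIV" and "fps_nth f 0 = 1" "m > 0" "coprime m p"
  shows "f \<in> supp_mod p UNIV"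
proof -
  have "fps_nth f n \<in> localization_at p" for n
  proof (induction n rule: less_induct)
    case (less n)
    show ?case
    proof (cases "n = 0")
      case False
      define g where "g = fps_cutoff n f"
      have "g \<in> supp_mod p UNIV"
        by (simp add: g_def supp_mod_UNIV less.IH)
      then have "g ^ m \<in> supp_mod p UNIV"
        by (rule supp_mod_power)
      moreover have "fps_nth (f ^ m) n - fps_nth (g ^ m) n = of_nat m * (fps_nth f n - fps_nth g n)"
        using False assms(2) by (intro fps_nth_power_diff) (auto simp: g_def fps_X_power_dvd_iff)
      then have "fps_nth f n = (fps_nth (f ^ m) n - fps_nth (g ^ m) n) / of_nat m"
        using \<open>m > 0\<close> by (simp add: g_def)
      ultimately show ?thesis
        using assms by (auto intro!: localization_divide_of_nat localization_diff supp_mod_nth)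
    qed (simp add: assms)
  qed
  then show ?thesis by (simp add: supp_mod_UNIV)
qed

text \<open>Modulo p, f^p is a series in q^p. The derivative shows that n times its n-th coefficient
  is p times a p-integral number, and n is invertible unless p divides it.\<close>

lemma supp_mod_prime_power:
  assumes f: "f \<in> supp_mod p UNIV" and "prime p"
  shows "f ^ p \<in> supp_mod p {0}"
proof (rule supp_modI)
  show "fps_nth (f ^ p) n \<in> localization_at p" for n
    using supp_mod_power[OF f] by (rule supp_mod_nth)
next
  fix n assume n: "n mod p \<notin> {0}"
  then obtain k where k: "n = Suc k" by (cases n) auto
  have "coprime n p"
    using n \<open>prime p\<close> by (metis coprime_commute mod_0_imp_dvd dvd_imp_mod_0 prime_imp_coprime singletonI)
  \<comment> \<open>Compare coefficients in \<open>(f\<^sup>p)' = p f' f\<^sup>p\<^sup>-\<^sup>1\<close>.\<close>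
  define g where "g = fps_deriv f * f ^ (p - 1)"
  have "g \<in> supp_mod p UNIV"
    unfolding g_def using f
    by (intro supp_mod_mult[where S = UNIV and T = UNIV] supp_mod_power)
       (auto simp: supp_mod_UNIV simp del: of_nat_Suc intro!: localization_mult)
  have "fps_nth (fps_deriv (f ^ p)) k = of_nat p * fps_nth g k"
    by (simp add: fps_deriv_power g_def mult.assoc)
  then have "fps_nth (f ^ p) n = of_int p * (fps_nth g k / of_nat n)"
    using k by (simp add: field_simps del: of_nat_Suc)
  moreover have "fps_nth g k / of_nat n \<in> localization_at p"
    using \<open>coprime n p\<close> k by (intro localization_divide_of_nat supp_mod_nth[OF \<open>g \<in> _\<close>]) auto
  ultimately show "rat_cong p (fps_nth (f ^ p) n) 0"
    unfolding rat_cong_0_iff by blast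
qed

section \<open>Residues modulo 5 of the exponents\<close>

text \<open>For the residues t of \<open>n choose 2\<close> and c of n,
  \<open>double_choose_two\<close> gives 2 t + c = c c modulo 5, which determines t because 2 is
  invertible.\<close>

lemma choose_two_mod_5: "(n choose 2) mod 5 = [0, 0, 1, 3, 1] ! (n mod 5)"
proof -
  define c t where "c = n mod 5" and "t = (n choose 2) mod 5"
  have "(2 * t + c) mod 5 = (2 * (n choose 2) + n) mod 5"
    unfolding c_def t_def by (intro mod_add_cong) (simp_all add: mod_mult_right_eq)
  also have "\<dots> = (c * c) mod 5"
    by (simp add: double_choose_two c_def mod_mult_eq)
  finally have eq: "(2 * t + c) mod 5 = (c * c) mod 5" .
  have "c < 5" "t < 5" by (simp_all add: c_def t_def)
  then have "c = 0 \<or> c = 1 \<or> c = 2 \<or> c = 3 \<or> c = 4" "t = 0 \<or> t = 1 \<or> t = 2 \<or> t = 3 \<or> t = 4"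
    by linarith+
  then have "t = [0, 0, 1, 3, 1] ! c"
    using eq by (elim disjE) simp_all
  then show ?thesis by (simp add: c_def t_def)
qed

text \<open>These are the generalized pentagonal numbers n (3 n - 1) / 2 and n (3 n + 1) /
  2.\<close>

lemma pentagonal_mod_5:
  "(n * n + (n choose 2)) mod 5 \<in> {0, 1, 2}" "(n * n + (Suc n choose 2)) mod 5 \<in> {0, 1, 2}"
proof -
  define c where "c = n mod 5"
  have *: "(n * n + (n choose 2)) mod 5 = (c * c + [0, 0, 1, 3, 1] ! c) mod 5"
    unfolding c_def choose_two_mod_5[symmetric] by (intro mod_add_cong) (simp_all add: mod_mult_eq)
  have "(n * n + (n choose 2) + n) mod 5 = ((n * n + (n choose 2)) mod 5 + c) mod 5"
    by (simp add: c_def mod_simps)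
  then have **: "(n * n + (Suc n choose 2)) mod 5 = ((c * c + [0, 0, 1, 3, 1] ! c) mod 5 + c) mod 5"
    by (simp only: Suc_choose_two * add.assoc)
  have "c < 5" by (simp add: c_def)
  then consider "c = 0" | "c = 1" | "c = 2" | "c = 3" | "c = 4" by linarith
  then have "(n * n + (n choose 2)) mod 5 \<in> {0, 1, 2} \<and> (n * n + (Suc n choose 2)) mod 5 \<in> {0, 1, 2}"
    unfolding * ** by cases simp_all
  then show "(n * n + (n choose 2)) mod 5 \<in> {0, 1, 2}" "(n * n + (Suc n choose 2)) mod 5 \<in> {0, 1, 2}"
    by blast+
qed

lemma fps_const_minus_one_power: "fps_const ((-1) ^ n) = ((-1) ^ n :: 'a::comm_ring_1 fps)"
  by (simp only: fps_const_power[symmetric] fps_const_neg[symmetric] fps_const_1_eq_1)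

section \<open>Exponents in the Euler product and its cube modulo 5\<close>

lemma supp_mod_euler: "euler_power_neg (-1) \<in> supp_mod 5 {0, 1, 2}"
proof (rule supp_mod_approx)
  fix n
  define t :: "nat \<Rightarrow> rat fps" where "t s = (-1) ^ s * fps_X ^ (s * n + (Suc s choose 2)) * (\<Prod>k=s..<n. 1 - fps_X ^ Suc k)" for s
  have "(\<Sum>s\<le>n. t s) \<in> supp_mod 5 {0, 1, 2}"
  proof -
    have mono: "(-1) ^ s * fps_X ^ k \<in> supp_mod 5 {0, 1, 2}" if "k mod 5 \<in> {0, 1, 2}" for s k
      using supp_mod_monomial[OF of_int_in_localization disjI1[OF that], of "(-1) ^ s"]
      by (simp add: fps_const_minus_one_power)
    have "1 \<in> supp_mod 5 {0, 1, 2}"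
      using mono[of 0 0] by simp
    then show ?thesis
      unfolding t_def shanks_identity distrib_left
      by (intro supp_mod_add supp_mod_sum mono pentagonal_mod_5)
  qed
  moreover have "fps_X ^ Suc n dvd euler_power_neg (-1) - (\<Sum>s\<le>n. t s)"
  proof -
    have "fps_X ^ Suc n dvd (\<Sum>s<n. t (Suc s))"
    proof (rule dvd_sum)
      fix s
      have "Suc n \<le> Suc s * n + (Suc (Suc s) choose 2)"
        by (simp add: Suc_choose_two)
      then show "fps_X ^ Suc n dvd t (Suc s)"
        unfolding t_def by (intro dvd_mult2 dvd_mult le_imp_power_dvd)
    qed
    \<comment> \<open>The summand s = 0 is the truncated Euler product itself.\<close>
    moreover have "(\<Sum>s\<le>n. t s) = q_poch fps_X n + (\<Sum>s<n. t (Suc s))"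
      unfolding lessThan_Suc_atMost[symmetric] sum.lessThan_Suc_shift
      by (simp add: t_def q_poch_def numeral_2_eq_2 atLeast0LessThan)
    ultimately show ?thesis
      using dvd_diff[OF euler_power_neg_minus_1_approx[of n n]] by (simp add: diff_diff_eq)
  qed
  ultimately show "\<exists>g\<in>supp_mod 5 {0, 1, 2}. fps_X ^ Suc n dvd euler_power_neg (-1) - g" by blast
qed

text \<open>Multiplying \<open>finite_jacobi_identity\<close> by E replaces each Gaussian binomial
  by 1 up to high order, and Jacobi's series g remains.\<close>

lemma supp_mod_euler_cube: "euler_power_neg (-1) ^ 3 \<in> supp_mod 5 {0, 1}"
proof (rule supp_mod_approx)
  fix n
  let ?E = "euler_power_neg (-1)"
  let ?B = "\<lambda>k. q_binomial fps_X (n + Suc n) k :: rat fps"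
  define g :: "rat fps" where "g = (\<Sum>j\<le>n. fps_const (of_int ((-1) ^ j * (2 * int j + 1))) * fps_X ^ (Suc j choose 2))"
  have "g \<in> supp_mod 5 {0, 1}"
    unfolding g_def
  proof (intro supp_mod_sum supp_mod_monomial of_int_in_localization)
    fix j
    show "(Suc j choose 2) mod 5 \<in> {0, 1} \<or> rat_cong (int 5) (of_int ((-1) ^ j * (2 * int j + 1))) 0"
    proof (cases "Suc j mod 5 = 3")
      case True
      \<comment> \<open>Here j is 2 modulo 5: the exponent has the forbidden residue 3, but the
        coefficient is divisible by 5.\<close>
      then have "2 * int j + 1 = 5 * int (2 * (Suc j div 5) + 1)"
        by presburger
      then have "rat_of_int ((-1) ^ j * (2 * int j + 1)) = of_int 5 * of_int ((-1) ^ j * int (2 * (Suc j div 5) + 1))"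
        by (simp only: of_int_mult mult_ac)
      then show ?thesis
        unfolding rat_cong_0_iff by (metis of_int_in_localization of_nat_numeral)
    next
      case False
      moreover have "Suc j mod 5 < 5" by simp
      ultimately consider "Suc j mod 5 = 0" | "Suc j mod 5 = 1" | "Suc j mod 5 = 2" | "Suc j mod 5 = 4"
        by linarith
      then have "(Suc j choose 2) mod 5 \<in> {0, 1}"
        unfolding choose_two_mod_5 by cases simp_all
      then show ?thesis ..
    qed
  qed
  moreover have "fps_X ^ Suc n dvd ?E ^ 3 - g"
  proof -
    have "?E ^ 3 - ?E * q_poch fps_X n ^ 2 = ?E * (?E * ?E) - ?E * (q_poch fps_X n * q_poch fps_X n)"
      by (simp add: power2_eq_square power3_eq_cube mult.assoc)
    also have "fps_X ^ Suc n dvd \<dots>"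
      by (intro dvd_diff_mult euler_power_neg_minus_1_approx) auto
    finally have 1: "fps_X ^ Suc n dvd ?E ^ 3 - ?E * q_poch fps_X n ^ 2" .
    have "?E * q_poch fps_X n ^ 2 - g = (\<Sum>j\<le>n. (-1) ^ j * fps_X ^ (Suc j choose 2) *
        (of_nat (n + Suc j) * (?E * ?B (n + Suc j) - 1) - of_nat (n - j) * (?E * ?B (n - j) - 1)))"
      unfolding finite_jacobi_identity[OF fps_X_neq_zero] g_def sum_distrib_left sum_subtractf[symmetric]
    proof (rule sum.cong)
      fix j assume "j \<in> {..n}"
      then obtain d where n: "n = j + d" by (auto simp: le_iff_add)
      \<comment> \<open>The weights n + 1 + j and n - j differ by 2 j + 1, the coefficient in
        Jacobi's series.\<close>
      have "fps_const (of_int ((-1) ^ j * (2 * int j + 1))) = (-1) ^ j * (of_nat (n + Suc j) - of_nat (n - j) :: rat fps)"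
        by (simp add: n flip: fps_const_power fps_const_neg fps_of_nat fps_const_mult fps_const_add fps_const_sub)
      then show "?E * ((-1) ^ j * fps_X ^ (Suc j choose 2) *
          (of_nat (n + Suc j) * ?B (n + Suc j) - of_nat (n - j) * ?B (n - j))) -
          fps_const (of_int ((-1) ^ j * (2 * int j + 1))) * fps_X ^ (Suc j choose 2) =
        (-1) ^ j * fps_X ^ (Suc j choose 2) *
        (of_nat (n + Suc j) * (?E * ?B (n + Suc j) - 1) - of_nat (n - j) * (?E * ?B (n - j) - 1))"
        by (simp only:) (simp add: algebra_simps)
    qed simp
    also have "fps_X ^ Suc n dvd \<dots>"
    proof (rule dvd_sum)
      fix j assume "j \<in> {..n}"
      then obtain d where n: "n = j + d" by (auto simp: le_iff_add)
      \<comment> \<open>For large j the binomials are precise only up to X^(d + 1) with d = n - j;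
        the factor with exponent \<open>Suc j choose 2\<close>, at least j, makes up the
        loss.\<close>
      have "fps_X ^ Suc d dvd ?E * ?B (n + Suc j) - 1" "fps_X ^ Suc d dvd ?E * ?B (n - j) - 1"
        using euler_mult_q_binomial_approx[of d d "n + Suc j"]
              euler_mult_q_binomial_approx[of d "n + Suc j" d]
        by (simp_all add: n add_ac)
      then have "fps_X ^ Suc d dvd of_nat (n + Suc j) * (?E * ?B (n + Suc j) - 1) - of_nat (n - j) * (?E * ?B (n - j) - 1)"
        by (rule dvd_diff[OF dvd_mult dvd_mult])
      then have "fps_X ^ ((Suc j choose 2) + Suc d) dvd (-1) ^ j * fps_X ^ (Suc j choose 2) *
        (of_nat (n + Suc j) * (?E * ?B (n + Suc j) - 1) - of_nat (n - j) * (?E * ?B (n - j) - 1))"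
        unfolding power_add by (intro mult_dvd_mono dvd_triv_right)
      then show "fps_X ^ Suc n dvd (-1) ^ j * fps_X ^ (Suc j choose 2) *
        (of_nat (n + Suc j) * (?E * ?B (n + Suc j) - 1) - of_nat (n - j) * (?E * ?B (n - j) - 1))"
        by (rule dvd_trans[OF le_imp_power_dvd, rotated]) (simp add: n Suc_choose_two)
    qed
    finally show ?thesis using 1 by (rule dvd_diff_trans[rotated])
  qed
  ultimately show "\<exists>g\<in>supp_mod 5 {0, 1}. fps_X ^ Suc n dvd ?E ^ 3 - g" by blast
qed

text \<open>For \<open>s = a / b\<close> the \<open>b\<close>-th power of the series has integral coefficients, and \<open>b\<close> is invertible.\<close>

lemma supp_mod_euler_power_neg:
  assumes "s \<in> localization_at (int p)"
  shows "euler_power_neg s \<in> supp_mod p UNIV"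
proof -
  obtain a b where b: "b > 0" and "coprime b (int p)" and s: "s = of_int a / of_int b"
  proof -
    obtain a b where q: "quotient_of s = (a, b)" by fastforce
    show ?thesis
      using that[of b a] assms quotient_of_denom_pos[OF q] quotient_of_div[OF q] q
      by (simp add: localization_at_def)
  qed
  have E: "euler_power_neg (-1) \<in> supp_mod p UNIV"
  proof (rule supp_mod_approx)
    fix n
    have "1 - fps_X ^ Suc k \<in> supp_mod p UNIV" for k
      unfolding supp_mod_UNIV fps_sub_nth fps_X_power_nth fps_one_nth
      by (intro allI localization_diff) simp_all
    then have "q_poch fps_X n \<in> supp_mod p UNIV"
      by (induction n)
         (simp_all add: q_poch_Suc supp_mod_one supp_mod_mult[where S = UNIV and T = UNIV] del: power_Suc)
    then show "\<exists>g\<in>supp_mod p UNIV. fps_X ^ Suc n dvd euler_power_neg (-1) - g"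
      using euler_power_neg_minus_1_approx by blast
  qed
  have E': "euler_power_neg 1 \<in> supp_mod p UNIV"
  proof (rule supp_mod_inverse[OF E])
    show "euler_power_neg (-1) * euler_power_neg 1 = 1"
      unfolding euler_power_neg_add[symmetric] by simp
  qed simp
  have a: "euler_power_neg (of_int a) \<in> supp_mod p UNIV"
  proof (cases a rule: int_cases2)
    case (nonneg n)
    then have "euler_power_neg (of_int a) = euler_power_neg 1 ^ n"
      using euler_power_neg_of_nat_mult[of n 1] by simp
    then show ?thesis using supp_mod_power[OF E'] by (simp only:)
  next
    case (nonpos n)
    then have "euler_power_neg (of_int a) = euler_power_neg (-1) ^ n"
      using euler_power_neg_of_nat_mult[of n "-1"] by simp
    then show ?thesis using supp_mod_power[OF E] by (simp only:)
  qed
  have "of_int a = of_nat (nat b) * s"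
    using b s by simp
  then have root: "euler_power_neg s ^ nat b \<in> supp_mod p UNIV"
    using a by (simp only: euler_power_neg_of_nat_mult)
  have "coprime (int (nat b)) (int p)"
    using b \<open>coprime b (int p)\<close> by simp
  then have "coprime (nat b) p"
    by (simp only: coprime_int_iff)
  with b show ?thesis
    by (intro supp_mod_root[OF root]) simp_all
qed

lemma supp_mod_euler_power_neg_mult:
  assumes "s \<in> localization_at (int p)" "prime p"
  shows "euler_power_neg (of_nat p * s) \<in> supp_mod p {0}"
  unfolding euler_power_neg_of_nat_mult
  using assms by (intro supp_mod_prime_power supp_mod_euler_power_neg)

text \<open>With r = c + 5 z one gets r = 5 (z + k) - a, so the series is one supported on residue 0
  times E^a. Since S consists of reduced residues, adding 0 modulo 5 keeps it unchanged.\<close>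

lemma supp_mod_euler_power_neg_shift:
  assumes r: "rat_cong 5 r c" and c: "c + of_nat a = 5 * of_nat k"
    and a: "euler_power_neg (-1) ^ a \<in> supp_mod 5 S" and "S \<subseteq> {..<5}"
  shows "euler_power_neg r \<in> supp_mod 5 S"
proof -
  obtain z where z: "z \<in> localization_at (int 5)" "r - c = 5 * z"
    using r by (auto simp: rat_cong_def)
  have "r = of_nat 5 * (z + of_nat k) + of_nat a * (-1)"
    using z(2) c by simp
  then have "euler_power_neg r = euler_power_neg (of_nat 5 * (z + of_nat k)) * euler_power_neg (-1) ^ a"
    by (simp only: euler_power_neg_add euler_power_neg_of_nat_mult[of a])
  also have "\<dots> \<in> supp_mod 5 S"
    using \<open>S \<subseteq> _\<close> by (intro supp_mod_mult[OF supp_mod_euler_power_neg_mult a] localization_add z) auto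
  finally show ?thesis .
qed

theorem theorem7p1:
  fixes r :: rat and m :: nat
  shows "(rat_cong 5 r 0 \<longrightarrow> rat_cong 5 (P r (5 * m + 1)) 0) \<and>
         (rat_cong 5 r 2 \<longrightarrow> rat_cong 5 (P r (5 * m + 2)) 0) \<and>
         (rat_cong 5 r 4 \<longrightarrow> rat_cong 5 (P r (5 * m + 3)) 0) \<and>
         (rat_cong 5 r 1 \<longrightarrow> rat_cong 5 (P r (5 * m + 4)) 0)"
proof -
  let ?E = "euler_power_neg (-1)"
  have coeff: "rat_cong 5 (P r n) 0" if "euler_power_neg r \<in> supp_mod 5 S" "n mod 5 \<notin> S" for n S
    using supp_mod_cong_0[OF that] by (simp add: P_def)
  have E0: "?E ^ 0 \<in> supp_mod 5 {0}"
    using supp_mod_monomial[of 1 5 0 "{0}"] by simp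
  have E1: "?E ^ 1 \<in> supp_mod 5 {0, 1, 2}"
    using supp_mod_euler by simp
  have "?E * ?E ^ 3 \<in> supp_mod 5 {0, 1, 2, 3}"
    by (rule supp_mod_mult[OF supp_mod_euler supp_mod_euler_cube]) auto
  then have E4: "?E ^ 4 \<in> supp_mod 5 {0, 1, 2, 3}"
    by (simp only: power_Suc[symmetric] Suc_numeral) simp
  show ?thesis
  proof (intro conjI impI)
    assume "rat_cong 5 r 0"
    then have "euler_power_neg r \<in> supp_mod 5 {0}"
      by (rule supp_mod_euler_power_neg_shift[where k = 0, OF _ _ E0]) auto
    then show "rat_cong 5 (P r (5 * m + 1)) 0" by (rule coeff) (simp only: mod_mult_self4, simp)
  next
    assume "rat_cong 5 r 2"
    then have "euler_power_neg r \<in> supp_mod 5 {0, 1}"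
      by (rule supp_mod_euler_power_neg_shift[where k = 1, OF _ _ supp_mod_euler_cube]) auto
    then show "rat_cong 5 (P r (5 * m + 2)) 0" by (rule coeff) (simp only: mod_mult_self4, simp)
  next
    assume "rat_cong 5 r 4"
    then have "euler_power_neg r \<in> supp_mod 5 {0, 1, 2}"
      by (rule supp_mod_euler_power_neg_shift[where k = 1, OF _ _ E1]) auto
    then show "rat_cong 5 (P r (5 * m + 3)) 0" by (rule coeff) (simp only: mod_mult_self4, simp)
  next
    assume "rat_cong 5 r 1"
    then have "euler_power_neg r \<in> supp_mod 5 {0, 1, 2, 3}"
      by (rule supp_mod_euler_power_neg_shift[where k = 1, OF _ _ E4]) auto
    then show "rat_cong 5 (P r (5 * m + 4)) 0" by (rule coeff) (simp only: mod_mult_self4, simp)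
  qed
qed

end
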